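(* Let $u:\mathbb{R}^2\to\mathbb{C}$ be the piecewise linear function $$u(x)=\sum_{j=1}^J(\alpha_j^Tx+\beta_j)\,1_{\Omega_j}(x),\qquad \alpha_j\in\mathbb{C}^2,\ \beta_j\in\mathbb{C},$$ where $\Omega_1,\dots,\Omega_J\subset[-1/2,1/2)^2$ are pairwise disjoint domains and the representation uses the smallest possible number of characteristic functions. Suppose that $\Gamma=\bigcup_{j=1}^J\partial\Omega_j$ satisfies $$\Gamma\subseteq\{x\in\mathbb{R}^2:\varphi(x)=0\},\qquad \varphi(x)=\sum_{k\in K}a(k)e^{-2\pi i k\cdot x},$$ where $\varphi$ is the minimal polynomial for $\Gamma$, with coefficients on the finite symmetric rectangular index set $K\subset\mathbb{Z}^2$. Let $p=(p_1,p_2):\mathbb{R}^2\to\mathbb{C}^2$ be an integrable, compactly supported vector field such that for every $\xi\in\mathbb{R}^2$ $$\sum_{k\in K}\mathcal{F}(\nabla u-p)(\xi+k)\,a(k)=0,\qquad \sum_{k\in K}\mathcal{F}(\nabla_s p)(\xi+k)\,a(k)=0 .$$ Let $K'\subset\mathbb{Z}^2$ be a finite symmetric rectangular index set strictly containing $K$, and let $\mathcal{H}$ denote the multi-fold Hankel matrix construction with filter support $K'$ on the grid $O$. Then $$\operatorname{rank}\,\mathcal{H}\big(\mathcal{F}(\nabla u-p)|_{O}\big)\le|K'|-|K':K|,\qquad \operatorname{rank}\,\mathcal{H}\big(\mathcal{F}(\nabla_sp)|_{O}\big)\le|K'|-|K':K|.$$ Hence both matrices are rank deficient, i.e. each has a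 nontrivial null space (rank strictly less than its number of columns $|K'|$).
   Context: Fourier transform: $\mathcal{F}(f)(\xi)=\int_{\mathbb{R}^2}f(x)e^{-2\pi i\xi\cdot x}\,dx$, extended to tempered distributions and applied componentwise; for compactly supported distributions it is a smooth function. Derivatives are distributional; the symmetric gradient of $p=(p_1,p_2)$ is $$\nabla_sp=\begin{pmatrix}\partial_1p_1&\tfrac12(\partial_2p_1+\partial_1p_2)\\ \tfrac12(\partial_2p_1+\partial_1p_2)&\partial_2p_2\end{pmatrix}.$$ A symmetric rectangular index set has the form $\{-m_1,\dots,m_1\}\times\{-m_2,\dots,m_2\}$. The minimal polynomial for $\Gamma$ is the nonzero trigonometric polynomial $\varphi$ vanishing on $\Gamma$ of smallest degree, where the degree is the ordered pair of degrees in each coordinate; $K$ is then the smallest rectangular support of its coefficients. The sample grid is $O=\{-\lfloor N/2\rfloor,\dots,\lfloor (N-1)/2\rfloor\}^2$ with $N\in\mathbb{N}$. For rectangular grids $A,B\subset\mathbb{Z}^2$, $A:B=\{k\in A: k+m\in A\text{ for all }m\in B\}$. For $v:O\to\mathbb{C}$, the Hankel matrix $\mathcal{H}v$ with filter support $K'$ is the $|O:K'|\times|K'|$ matrix with entries $(\mathcal{H}v)(k,m)=v(k+m)$, $k\in O:K'$, $m\in K'$. For a tuple $q=(q_1,\dots,q_n)$ of functions on $O$ (the 2 components of $\mathcal{F}(\nabla u-p)|_O$, or the 4 components of $\mathcal{F}(\nabla_sp)|_O$), the multi-fold Hankel matrix $\mathcal{H}q$ is obtained by stacking $\mathcal{H}q_1,\dots,\mathcal{H}q_n$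 vertically (so it has $|K'|$ columns). *)

theory Defs
  imports
    "HOL-Analysis.Analysis"
    "Jordan_Normal_Form.DL_Rank"
    "Jordan_Normal_Form.Matrix_Kernel"
begin

type_synonym plane = "real \<times> real"
type_synonym index = "int \<times> int"

abbreviation lattice_pt :: "index \<Rightarrow> plane"
  where "lattice_pt k \<equiv> (real_of_int (fst k), real_of_int (snd k))"

definition exp_char :: "plane \<Rightarrow> plane \<Rightarrow> complex"
  where "exp_char \<xi> x = exp (- (2 * complex_of_real pi * \<i> * complex_of_real (inner \<xi> x)))"


section \<open>Tempered distributions on the plane\<close>

abbreviation e1 :: plane where "e1 \<equiv> (1, 0)"
abbreviation e2 :: plane where "e2 \<equiv> (0, 1)"

definition pderiv_dir :: "plane \<Rightarrow> (plane \<Rightarrow> complex) \<Rightarrow> plane \<Rightarrow> complex"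
  where "pderiv_dir e f x = frechet_derivative f (at x) e"

definition pderivs :: "plane list \<Rightarrow> (plane \<Rightarrow> complex) \<Rightarrow> plane \<Rightarrow> complex"
  where "pderivs es f = foldr pderiv_dir es f"

definition smooth :: "(plane \<Rightarrow> complex) \<Rightarrow> bool"
  where "smooth f \<longleftrightarrow> (\<forall>es\<in>lists {e1, e2}. \<forall>x. pderivs es f differentiable (at x))"

definition schwartz :: "(plane \<Rightarrow> complex) set"
  where "schwartz = {f. smooth f \<and>
    (\<forall>es\<in>lists {e1, e2}. \<forall>n. bounded (range (\<lambda>x. norm x ^ n *\<^sub>R pderivs es f x)))}"

text \<open>
  A distribution is represented by a functional of which only the values on \<^const>\<open>schwartz\<close>
  matter. Linearity and continuity are not built into the type: the functionals used below are
  linear combinations of first derivatives of integrable functions, which are tempered.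
\<close>

type_synonym distribution = "(plane \<Rightarrow> complex) \<Rightarrow> complex"

definition dist_of :: "(plane \<Rightarrow> complex) \<Rightarrow> distribution"
  where "dist_of f = (\<lambda>\<psi>. LINT x|lebesgue. f x * \<psi> x)"

definition dist_deriv :: "plane \<Rightarrow> distribution \<Rightarrow> distribution"
  where "dist_deriv e T = (\<lambda>\<psi>. - T (pderiv_dir e \<psi>))"

definition fourier_integral :: "(plane \<Rightarrow> complex) \<Rightarrow> plane \<Rightarrow> complex"
  where "fourier_integral f \<xi> = (LINT x|lebesgue. f x * exp_char \<xi> x)"

definition dist_fourier :: "distribution \<Rightarrow> distribution"
  where "dist_fourier T = (\<lambda>\<psi>. T (fourier_integral \<psi>))"

text \<open>
  For a compactly supported \<open>T\<close>, the tempered distribution \<^term>\<open>dist_fourier T\<close> is given by a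
  unique smooth function; this is the function whose point values are meant by \<open>F(T)(\<xi>)\<close>.
\<close>

definition fourier :: "distribution \<Rightarrow> plane \<Rightarrow> complex"
  where "fourier T = (THE g. smooth g \<and>
    (\<forall>\<psi>\<in>schwartz. integrable lebesgue (\<lambda>x. g x * \<psi> x) \<and> dist_fourier T \<psi> = dist_of g \<psi>))"

text \<open>Vector- and matrix-valued distributions are lists of their components (row by row).\<close>

definition grad_minus :: "(plane \<Rightarrow> complex) \<Rightarrow> (plane \<Rightarrow> complex \<times> complex) \<Rightarrow> distribution list"
  where "grad_minus u p =
    [\<lambda>\<psi>. dist_deriv e1 (dist_of u) \<psi> - dist_of (\<lambda>x. fst (p x)) \<psi>,
     \<lambda>\<psi>. dist_deriv e2 (dist_of u) \<psi> - dist_of (\<lambda>x. snd (p x)) \<psi>]"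

definition sym_grad :: "(plane \<Rightarrow> complex \<times> complex) \<Rightarrow> distribution list"
  where "sym_grad p =
    (let p1 = dist_of (\<lambda>x. fst (p x)); p2 = dist_of (\<lambda>x. snd (p x));
         off = (\<lambda>\<psi>. 1 / 2 * (dist_deriv e2 p1 \<psi> + dist_deriv e1 p2 \<psi>))
     in [dist_deriv e1 p1, off, off, dist_deriv e2 p2])"


section \<open>Piecewise linear functions\<close>

definition pw_linear_rep ::
  "(plane \<Rightarrow> complex) \<Rightarrow> nat \<Rightarrow> (nat \<Rightarrow> complex \<times> complex) \<Rightarrow> (nat \<Rightarrow> complex) \<Rightarrow>
   (nat \<Rightarrow> plane set) \<Rightarrow> bool"
  where "pw_linear_rep u J \<alpha> \<beta> \<Omega> \<longleftrightarrow>
    (\<forall>j\<in>{1..J}. open (\<Omega> j) \<and> connected (\<Omega> j) \<and> \<Omega> j \<noteq> {} \<and>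
       \<Omega> j \<subseteq> {-1/2..<1/2} \<times> {-1/2..<1/2}) \<and>
    disjoint_family_on \<Omega> {1..J} \<and>
    (\<forall>x. u x = (\<Sum>j=1..J.
       (fst (\<alpha> j) * complex_of_real (fst x) + snd (\<alpha> j) * complex_of_real (snd x) + \<beta> j) *
       indicator (\<Omega> j) x))"

definition minimal_pw_linear_rep ::
  "(plane \<Rightarrow> complex) \<Rightarrow> nat \<Rightarrow> (nat \<Rightarrow> complex \<times> complex) \<Rightarrow> (nat \<Rightarrow> complex) \<Rightarrow>
   (nat \<Rightarrow> plane set) \<Rightarrow> bool"
  where "minimal_pw_linear_rep u J \<alpha> \<beta> \<Omega> \<longleftrightarrow>
    pw_linear_rep u J \<alpha> \<beta> \<Omega> \<and> (\<forall>J' \<alpha>' \<beta>' \<Omega>'. pw_linear_rep u J' \<alpha>' \<beta>' \<Omega>' \<longrightarrow> J \<le> J')"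


section \<open>Trigonometric polynomials\<close>

definition sym_rect :: "index set \<Rightarrow> bool"
  where "sym_rect A \<longleftrightarrow> (\<exists>m1 m2 :: nat. A = {- int m1..int m1} \<times> {- int m2..int m2})"

definition coeff_supp :: "(index \<Rightarrow> complex) \<Rightarrow> index set"
  where "coeff_supp a = {k. a k \<noteq> 0}"

definition trig_poly :: "(index \<Rightarrow> complex) \<Rightarrow> plane \<Rightarrow> complex"
  where "trig_poly a x = (\<Sum>k\<in>coeff_supp a. a k * exp_char (lattice_pt k) x)"

text \<open>As usual, a sum over \<open>\<bar>k\<bar> \<le> m\<close> in one coordinate has degree at most \<open>m\<close> in it.\<close>

definition trig_degree :: "(index \<Rightarrow> complex) \<Rightarrow> int \<times> int"
  where "trig_degree a =
    (Max ((\<lambda>k. \<bar>fst k\<bar>) ` coeff_supp a), Max ((\<lambda>k. \<bar>snd k\<bar>) ` coeff_supp a))"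

definition vanishing_trig_poly :: "plane set \<Rightarrow> (index \<Rightarrow> complex) \<Rightarrow> bool"
  where "vanishing_trig_poly \<Gamma> a \<longleftrightarrow>
    finite (coeff_supp a) \<and> trig_poly a \<noteq> (\<lambda>x. 0) \<and> (\<forall>x\<in>\<Gamma>. trig_poly a x = 0)"

text \<open>Degree pairs are compared coordinatewise.\<close>

definition minimal_trig_poly :: "plane set \<Rightarrow> (index \<Rightarrow> complex) \<Rightarrow> bool"
  where "minimal_trig_poly \<Gamma> a \<longleftrightarrow> vanishing_trig_poly \<Gamma> a \<and>
    (\<forall>b. vanishing_trig_poly \<Gamma> b \<longrightarrow>
       fst (trig_degree a) \<le> fst (trig_degree b) \<and> snd (trig_degree a) \<le> snd (trig_degree b))"

definition smallest_rect_supp :: "(index \<Rightarrow> complex) \<Rightarrow> index set \<Rightarrow> bool"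
  where "smallest_rect_supp a K \<longleftrightarrow> sym_rect K \<and> coeff_supp a \<subseteq> K \<and>
    (\<forall>L. sym_rect L \<and> coeff_supp a \<subseteq> L \<longrightarrow> K \<subseteq> L)"


section \<open>Hankel matrices\<close>

definition sample_grid :: "nat \<Rightarrow> index set"
  where "sample_grid N =
    {- \<lfloor>real N / 2\<rfloor>..\<lfloor>(real N - 1) / 2\<rfloor>} \<times> {- \<lfloor>real N / 2\<rfloor>..\<lfloor>(real N - 1) / 2\<rfloor>}"

definition grid_diff :: "index set \<Rightarrow> index set \<Rightarrow> index set"  (infix \<open>|:|\<close> 55)
  where "A |:| B = {k \<in> A. \<forall>m\<in>B. k + m \<in> A}"

text \<open>
  Rows and columns are indexed by grid points; \<^const>\<open>from_nat_into\<close> enumerates them. The choice of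
  enumeration permutes rows and columns only. The entries use \<open>v\<close> only on the grid \<open>G\<close>.
\<close>

definition hankel :: "index set \<Rightarrow> index set \<Rightarrow> (index \<Rightarrow> complex) \<Rightarrow> complex mat"
  where "hankel G M v = mat (card (G |:| M)) (card M)
    (\<lambda>(i, j). v (from_nat_into (G |:| M) i + from_nat_into M j))"

definition multi_hankel :: "index set \<Rightarrow> index set \<Rightarrow> (index \<Rightarrow> complex) list \<Rightarrow> complex mat"
  where "multi_hankel G M q =
    foldr (\<lambda>v A. append_rows (hankel G M v) A) q (0\<^sub>m 0 (card M))"

definition mat_rank :: "complex mat \<Rightarrow> nat"
  where "mat_rank A = vec_space.rank (dim_row A) A"

definition lattice_samples :: "distribution list \<Rightarrow> (index \<Rightarrow> complex) list"
  where "lattice_samples Ts = map (\<lambda>T k. fourier T (lattice_pt k)) Ts"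

end

theory Submission
  imports Defs
begin

text \<open>
  Write \<open>c(m)\<close> for the column of the Hankel matrix with index \<open>m\<close>. Evaluating the annihilation
  relation at lattice points gives \<open>\<Sum>k\<in>K. a(k) c(s + k) = 0\<close> for every \<open>s\<close> in \<open>K' : K\<close>.
  If \<open>k\<^sub>0\<close> is the lexicographically largest element of the support of \<open>a\<close>, this expresses
  \<open>c(s + k\<^sub>0)\<close> through columns with smaller index. Hence the \<open>|K'| - |K' : K|\<close> columns with
  index outside \<open>(K' : K) + k\<^sub>0\<close> span the column space. The relation for \<open>s = 0\<close> is a null
  vector.
\<close>

section \<open>Lexicographic order on the index plane\<close>

definition lex_less :: "index \<Rightarrow> index \<Rightarrow> bool"
  where "lex_less k l \<longleftrightarrow> fst k < fst l \<or> fst k = fst l \<and> snd k < snd l"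

lemma lex_less_add_left_iff: "lex_less (s + k) (s + l) \<longleftrightarrow> lex_less k l"
  by (auto simp: lex_less_def)

text \<open>The order is not well-founded on the whole index plane, but on a finite set transitivity
  and irreflexivity exclude cycles. This licenses the induction over column indices.\<close>

lemma wf_lex_less_on_finite:
  assumes "finite M"
  shows "wf {(k, l). k \<in> M \<and> l \<in> M \<and> lex_less k l}"
proof (rule finite_acyclic_wf)
  let ?r = "{(k, l). k \<in> M \<and> l \<in> M \<and> lex_less k l}"
  show "finite ?r"
    by (rule finite_subset[of _ "M \<times> M"]) (use assms in auto)
  have "trans ?r"
    by (auto simp: trans_def lex_less_def)
  then show "acyclic ?r"
    by (simp add: acyclic_def lex_less_def)
qed

lemma finite_has_lex_greatest:
  assumes "finite F" "F \<noteq> {}"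
  obtains k\<^sub>0 where "k\<^sub>0 \<in> F" "\<And>k. k \<in> F \<Longrightarrow> k \<noteq> k\<^sub>0 \<Longrightarrow> lex_less k k\<^sub>0"
proof -
  have "\<exists>k\<^sub>0\<in>F. \<forall>k\<in>F. k \<noteq> k\<^sub>0 \<longrightarrow> lex_less k k\<^sub>0"
    using assms
  proof (induction F rule: finite_ne_induct)
    case (insert l F)
    then obtain k\<^sub>0 where k0: "k\<^sub>0 \<in> F" "\<forall>k\<in>F. k \<noteq> k\<^sub>0 \<longrightarrow> lex_less k k\<^sub>0"
      by blast
    have "l \<noteq> k\<^sub>0"
      using insert k0 by auto
    then consider "lex_less l k\<^sub>0" | "lex_less k\<^sub>0 l"
      by (metis lex_less_def not_less_iff_gr_or_eq prod_eqI)
    then show ?case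
    proof cases
      case 1
      then show ?thesis using k0 by auto
    next
      case 2
      then have "\<forall>k\<in>F. lex_less k l"
        using k0(2) by (fastforce simp: lex_less_def)
      then show ?thesis by blast
    qed
  qed simp
  then show thesis
    using that by blast
qed

section \<open>Spans of columns and rank\<close>

lemma (in vec_space) sum_vec_in_span:
  assumes "finite F" "B \<subseteq> carrier_vec n" "\<And>k. k \<in> F \<Longrightarrow> vec n (f k) \<in> span B"
  shows "vec n (\<lambda>i. \<Sum>k\<in>F. f k i) \<in> span B"
  using assms(1,3)
proof (induction F rule: finite_induct)
  case empty
  then show ?case
    using vectorspace.span_zero[OF vec_vs, of n B] by (simp add: zero_vec_def)
next
  case (insert k F)
  have "vec n (\<lambda>i. \<Sum>k\<in>insert k F. f k i) = vec n (f k) + vec n (\<lambda>i. \<Sum>k\<in>F. f k i)"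
    using insert.hyps by (intro eq_vecI) auto
  then show ?case
    using span_add1[OF assms(2)] insert by simp
qed

text \<open>The rank is by definition the dimension of the column span. Both inclusions together
  identify this span with \<open>span B\<close>, and a finite generating set bounds the
  dimension.\<close>

lemma (in vec_space) rank_le_card_spanning_cols:
  assumes A: "A \<in> carrier_mat n nc"
    and B: "B \<subseteq> set (cols A)" "set (cols A) \<subseteq> span B"
  shows "rank A \<le> card B"
proof -
  have BV: "B \<subseteq> carrier_vec n"
    using A B(1) cols_dim by blast
  have sub: "submodule class_ring (span B) V"
    using BV by (rule span_is_submodule)
  have eq: "span (set (cols A)) = span B"
    using span_is_subset[OF B(2) sub] span_is_monotone[OF B(1)] by blast
  interpret W: vectorspace class_ring "vs (span B)"
    using BV by (intro subspace_is_vs span_is_subspace) simp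
  have "B \<subseteq> span B"
    using BV by (rule in_own_span[simplified])
  moreover have "finite B"
    using B(1) finite_subset by auto
  \<comment> \<open>Generation has to hold inside the subspace \<open>span B\<close>; the span of
    \<open>B\<close> formed there agrees with the span in the ambient space.\<close>
  ultimately have "W.dim \<le> card B"
    using span_li_not_depend(1)[OF _ sub, of B] by (intro W.gen_ge_dim) auto
  then show ?thesis
    by (simp add: rank_def eq)
qed

section \<open>Rank and kernel from annihilation relations\<close>

definition annihilated :: "index set \<Rightarrow> (index \<Rightarrow> complex) \<Rightarrow> (index \<Rightarrow> complex) \<Rightarrow> bool"
  where "annihilated K a w \<longleftrightarrow> (\<forall>s. (\<Sum>k\<in>K. w (s + k) * a k) = 0)"

lemma annihilatedD: "annihilated K a w \<Longrightarrow> (\<Sum>k\<in>K. w (s + k) * a k) = 0"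
  unfolding annihilated_def by blast

lemma annihilated_shift: "annihilated K a w \<Longrightarrow> annihilated K a (\<lambda>m. w (l + m))"
  by (simp add: annihilated_def del: split_paired_All flip: add.assoc)

text \<open>Each row is only assumed to be the restriction to \<open>M\<close> of an annihilated
  function on the whole index plane. Different rows may use different functions, so stacked matrices
  are covered as well.\<close>

lemma mat_rank_le_of_annihilated:
  fixes A :: "complex mat"
  assumes A: "A \<in> carrier_mat n (card M)"
    and M: "finite M"
    and K: "finite K" "coeff_supp a \<subseteq> K" "coeff_supp a \<noteq> {}"
    and rows: "\<And>i. i < n \<Longrightarrow> \<exists>w. annihilated K a w \<and>
      (\<forall>j<card M. A $$ (i, j) = w (from_nat_into M j))"
  shows "mat_rank A \<le> card M - card (M |:| K)"
proof -
  interpret vec_space "TYPE(complex)" n .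
  obtain w where w: "\<And>i. i < n \<Longrightarrow> annihilated K a (w i)"
      "\<And>i j. i < n \<Longrightarrow> j < card M \<Longrightarrow> A $$ (i, j) = w i (from_nat_into M j)"
    using rows by metis
  define c where "c m = vec n (\<lambda>i. w i m)" for m
  have "set (cols A) = (\<lambda>j. c (from_nat_into M j)) ` {..<card M}"
    using A w(2) by (auto simp: cols_def c_def atLeast0LessThan intro!: image_cong eq_vecI)
  then have cols_A: "set (cols A) = c ` M"
    using bij_betw_imp_surj_on[OF bij_betw_from_nat_into_finite[OF M]]
    by (simp flip: image_image)
  have fin: "finite (coeff_supp a)"
    using K finite_subset by blast
  obtain k\<^sub>0 where k0: "k\<^sub>0 \<in> coeff_supp a"
      "\<And>k. k \<in> coeff_supp a \<Longrightarrow> k \<noteq> k\<^sub>0 \<Longrightarrow> lex_less k k\<^sub>0"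
    using finite_has_lex_greatest[OF fin K(3)] by blast
  have shift: "s + k \<in> M" if "s \<in> M |:| K" "k \<in> coeff_supp a" for s k
    using that K(2) by (auto simp: grid_diff_def)
  \<comment> \<open>\<open>T\<close> collects the indices whose columns are eliminated;
    \<open>B\<close> consists of the remaining columns.\<close>
  define T where "T = (\<lambda>s. s + k\<^sub>0) ` (M |:| K)"
  define B where "B = c ` (M - T)"
  have BV: "B \<subseteq> carrier_vec n"
    by (auto simp: B_def c_def)
  have in_span: "m \<in> M \<longrightarrow> c m \<in> span B" for m
    using wf_lex_less_on_finite[OF M]
  proof (induction m rule: wf_induct_rule)
    case (less m)
    show ?case
    proof (cases "m \<in> M \<and> m \<in> T")
      case True
      then obtain s where s: "s \<in> M |:| K" "m = s + k\<^sub>0"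
        by (auto simp: T_def)
      let ?F = "coeff_supp a - {k\<^sub>0}"
      let ?f = "\<lambda>k i. - (a k / a k\<^sub>0) * w i (s + k)"
      have f_span: "vec n (?f k) \<in> span B" if k: "k \<in> ?F" for k
      proof -
        \<comment> \<open>Translation invariance places \<open>s + k\<close> below
          \<open>s + k\<^sub>0 = m\<close>, and \<open>shift\<close> keeps it in \<open>M\<close>,
          so the induction hypothesis applies.\<close>
        have "c (s + k) \<in> span B"
          using less[of "s + k"] k k0 shift[OF s(1)] True
          by (auto simp: s(2) lex_less_add_left_iff)
        then have "- (a k / a k\<^sub>0) \<cdot>\<^sub>v c (s + k) \<in> span B"
          using submodule.smult_closed[OF span_is_submodule[OF BV]] by auto
        also have "- (a k / a k\<^sub>0) \<cdot>\<^sub>v c (s + k) = vec n (?f k)"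
          by (intro eq_vecI) (auto simp: c_def)
        finally show ?thesis .
      qed
      \<comment> \<open>The relation at \<open>s\<close>, reduced to the support of
        \<open>a\<close>, is solved for its \<open>k\<^sub>0\<close> term;
        \<open>a k\<^sub>0\<close> is nonzero.\<close>
      have "w i m = (\<Sum>k\<in>?F. ?f k i)" if i: "i < n" for i
      proof -
        have "0 = (\<Sum>k\<in>coeff_supp a. w i (s + k) * a k)"
          using annihilatedD[OF w(1)[OF i], of s] K
          by (subst sum.mono_neutral_left[of K]) (auto simp: coeff_supp_def)
        also have "\<dots> = w i m * a k\<^sub>0 + (\<Sum>k\<in>?F. w i (s + k) * a k)"
          using fin k0(1) by (simp add: sum.remove s(2))
        finally have "w i m * a k\<^sub>0 = - (\<Sum>k\<in>?F. w i (s + k) * a k)"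
          by (simp add: eq_neg_iff_add_eq_0)
        then have "w i m = - (\<Sum>k\<in>?F. w i (s + k) * a k) / a k\<^sub>0"
          using k0(1) by (subst nonzero_eq_divide_eq) (auto simp: coeff_supp_def)
        then show ?thesis
          by (simp add: sum_divide_distrib sum_negf mult.commute)
      qed
      then have "c m = vec n (\<lambda>i. \<Sum>k\<in>?F. ?f k i)"
        unfolding c_def by (intro eq_vecI) auto
      then show ?thesis
        using sum_vec_in_span[of ?F B ?f] BV f_span fin by (simp only: finite_Diff simp_thms)
    next
      \<comment> \<open>Either \<open>m\<close> lies outside \<open>M\<close> and the claim is
        vacuous, or \<open>c m\<close> belongs to \<open>B\<close> itself.\<close>
      case False
      then show ?thesis
        using in_own_span[of B] BV by (auto simp: B_def)
    qed
  qed
  have "T \<subseteq> M"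
    unfolding T_def using shift k0(1) by blast
  have "mat_rank A = rank A"
    using A by (simp add: mat_rank_def)
  also have "\<dots> \<le> card B"
    using A by (rule rank_le_card_spanning_cols) (use in_span in \<open>auto simp: cols_A B_def\<close>)
  \<comment> \<open>Distinct indices may carry equal columns, hence only an inequality.\<close>
  also have "\<dots> \<le> card (M - T)"
    using M by (simp add: B_def card_image_le)
  also have "\<dots> = card M - card T"
    using \<open>T \<subseteq> M\<close> M by (simp add: card_Diff_subset finite_subset)
  \<comment> \<open>Translation by \<open>k\<^sub>0\<close> is injective.\<close>
  also have "card T = card (M |:| K)"
    by (simp add: T_def card_image)
  finally show ?thesis .
qed

text \<open>The null vector is \<open>a\<close> itself, listed in the enumeration of
  \<open>M\<close>. It is nonzero because the support of \<open>a\<close> is nonempty and lies in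
  \<open>M\<close>.\<close>

lemma mat_kernel_nontrivial_of_annihilated:
  fixes A :: "complex mat"
  assumes A: "A \<in> carrier_mat n (card M)"
    and M: "finite M"
    and K: "K \<subseteq> M" "coeff_supp a \<subseteq> K" "coeff_supp a \<noteq> {}"
    and rows: "\<And>i. i < n \<Longrightarrow> \<exists>w. annihilated K a w \<and>
      (\<forall>j<card M. A $$ (i, j) = w (from_nat_into M j))"
  shows "mat_kernel A \<noteq> {0\<^sub>v (card M)}"
proof -
  define x where "x = vec (card M) (\<lambda>j. a (from_nat_into M j))"
  note bij = bij_betw_from_nat_into_finite[OF M]
  have "A *\<^sub>v x = 0\<^sub>v n"
  proof (rule eq_vecI)
    fix i
    assume "i < dim_vec (0\<^sub>v n)"
    then have i: "i < n" by simp
    obtain w where w: "annihilated K a w" "\<And>j. j < card M \<Longrightarrow> A $$ (i, j) = w (from_nat_into M j)"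
      using rows[OF i] by blast
    have "(A *\<^sub>v x) $ i = (\<Sum>j<card M. w (from_nat_into M j) * a (from_nat_into M j))"
      using A i w(2) by (auto simp: scalar_prod_def x_def atLeast0LessThan intro!: sum.cong)
    also have "\<dots> = (\<Sum>m\<in>M. w m * a m)"
      using sum.reindex_bij_betw[OF bij, of "\<lambda>m. w m * a m"] .
    \<comment> \<open>Since \<open>a\<close> vanishes outside \<open>K\<close>, what remains is the
      relation at shift 0.\<close>
    also have "\<dots> = (\<Sum>m\<in>K. w m * a m)"
      using M K by (intro sum.mono_neutral_right) (auto simp: coeff_supp_def)
    also have "\<dots> = 0"
      using annihilatedD[OF w(1), of 0] by simp
    finally show "(A *\<^sub>v x) $ i = 0\<^sub>v n $ i"
      using i by simp
  qed (use A in auto)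
  then have "x \<in> mat_kernel A"
    using A by (intro mat_kernelI) (auto simp: x_def)
  moreover have "x \<noteq> 0\<^sub>v (card M)"
  proof -
    obtain k where "k \<in> M" "a k \<noteq> 0"
      using K by (auto simp: coeff_supp_def)
    moreover from this obtain j where "j < card M" "from_nat_into M j = k"
      using bij by (metis bij_betw_iff_bijections lessThan_iff)
    ultimately have "x $ j \<noteq> 0\<^sub>v (card M) $ j"
      by (simp add: x_def)
    then show ?thesis by metis
  qed
  ultimately show ?thesis by blast
qed

section \<open>Multi-fold Hankel matrices\<close>

lemma multi_hankel_rows:
  "\<exists>n. multi_hankel G M q \<in> carrier_mat n (card M) \<and> (\<forall>i<n. \<exists>v\<in>set q. \<exists>l. \<forall>j<card M.
     multi_hankel G M q $$ (i, j) = v (l + from_nat_into M j))"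
proof (induction q)
  case Nil
  then show ?case by (auto simp: multi_hankel_def intro: exI[of _ 0])
next
  case (Cons v q)
  let ?H = "hankel G M v" and ?R = "multi_hankel G M q"
  have eq: "multi_hankel G M (v # q) = append_rows ?H ?R"
    by (simp add: multi_hankel_def)
  obtain n where R: "?R \<in> carrier_mat n (card M)"
    and rows: "\<And>i. i < n \<Longrightarrow> \<exists>v\<in>set q. \<exists>l. \<forall>j<card M. ?R $$ (i, j) = v (l + from_nat_into M j)"
    using Cons.IH by blast
  have H: "?H \<in> carrier_mat (card (G |:| M)) (card M)"
    by (simp add: hankel_def)
  show ?case
  proof (intro exI conjI allI impI)
    show "multi_hankel G M (v # q) \<in> carrier_mat (card (G |:| M) + n) (card M)"
      unfolding eq using H R by (rule carrier_append_rows)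
    fix i
    assume i: "i < card (G |:| M) + n"
    show "\<exists>v'\<in>set (v # q). \<exists>l. \<forall>j<card M.
      multi_hankel G M (v # q) $$ (i, j) = v' (l + from_nat_into M j)"
    proof (cases "i < card (G |:| M)")
      case True
      then have "\<forall>j<card M. multi_hankel G M (v # q) $$ (i, j)
          = v (from_nat_into (G |:| M) i + from_nat_into M j)"
        using H R by (simp add: eq append_rows_def hankel_def)
      then show ?thesis
        by (meson list.set_intros(1))
    next
      case False
      \<comment> \<open>Below the first block the row index is offset by that block's number of
        rows.\<close>
      then have "\<forall>j<card M. multi_hankel G M (v # q) $$ (i, j) = ?R $$ (i - card (G |:| M), j)"
        using H R i by (simp add: eq append_rows_def)
      then show ?thesis
        using rows[of "i - card (G |:| M)"] False i by auto
    qed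
  qed
qed

text \<open>Every row is a translate of one of the functions in \<open>q\<close>, and annihilation
  survives translation, so both preceding results apply. The grid \<open>G\<close> affects only
  which rows occur and how many.\<close>

lemma multi_hankel_rank_deficient:
  fixes G :: "index set" and q :: "(index \<Rightarrow> complex) list"
  assumes M: "finite M" "0 \<in> M"
    and K: "K \<subseteq> M" "coeff_supp a \<subseteq> K" "coeff_supp a \<noteq> {}"
    and ann: "\<And>v. v \<in> set q \<Longrightarrow> annihilated K a v"
  defines "H \<equiv> multi_hankel G M q"
  shows "mat_rank H \<le> card M - card (M |:| K)" "mat_rank H < card M"
    "mat_kernel H \<noteq> {0\<^sub>v (card M)}"
proof -
  obtain n where H: "H \<in> carrier_mat n (card M)"
    and rows: "\<And>i. i < n \<Longrightarrow> \<exists>v\<in>set q. \<exists>l. \<forall>j<card M. H $$ (i, j) = v (l + from_nat_into M j)"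
    unfolding H_def using multi_hankel_rows by blast
  have rows': "\<exists>w. annihilated K a w \<and> (\<forall>j<card M. H $$ (i, j) = w (from_nat_into M j))"
    if "i < n" for i
  proof -
    obtain v l where v: "v \<in> set q" "\<forall>j<card M. H $$ (i, j) = v (l + from_nat_into M j)"
      using rows[OF \<open>i < n\<close>] by blast
    then show ?thesis
      using annihilated_shift[OF ann[OF v(1)], of l]
      by (intro exI[of _ "\<lambda>m. v (l + m)"] conjI)
  qed
  have "finite K"
    using M K finite_subset by blast
  then show rank: "mat_rank H \<le> card M - card (M |:| K)"
    using mat_rank_le_of_annihilated[OF H M(1) _ K(2,3) rows'] by blast
  have "finite (M |:| K)"
    using M(1) by (auto simp: grid_diff_def)
  \<comment> \<open>This is where \<open>K \<subseteq> M\<close> makes the rank bound strict: at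
    least one column is subtracted.\<close>
  moreover have "0 \<in> M |:| K"
    using M(2) K(1) by (auto simp: grid_diff_def)
  ultimately have "0 < card (M |:| K)"
    by (auto simp: card_gt_0_iff)
  \<comment> \<open>Subtraction on the naturals is truncated, so strictness also requires
    \<open>card M\<close> to be positive.\<close>
  moreover have "0 < card M"
    using M by (auto simp: card_gt_0_iff)
  ultimately show "mat_rank H < card M"
    using rank by linarith
  show "mat_kernel H \<noteq> {0\<^sub>v (card M)}"
    using mat_kernel_nontrivial_of_annihilated[OF H M(1) K rows'] by blast
qed

section \<open>From Fourier samples to the rank bounds\<close>

lemma lattice_samples_annihilated:
  assumes "\<And>\<xi> T. T \<in> set Ts \<Longrightarrow> (\<Sum>k\<in>K. fourier T (\<xi> + lattice_pt k) * a k) = 0"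
    and "v \<in> set (lattice_samples Ts)"
  shows "annihilated K a v"
proof -
  obtain T where T: "T \<in> set Ts" "v = (\<lambda>k. fourier T (lattice_pt k))"
    using assms(2) by (auto simp: lattice_samples_def)
  show ?thesis
    unfolding annihilated_def
  proof
    fix s
    show "(\<Sum>k\<in>K. v (s + k) * a k) = 0"
      using assms(1)[OF T(1), of "lattice_pt s"] by (simp add: T(2))
  qed
qed

theorem proposition2p6:
  fixes u :: "plane \<Rightarrow> complex" and J N :: nat
    and \<alpha> :: "nat \<Rightarrow> complex \<times> complex" and \<beta> :: "nat \<Rightarrow> complex" and \<Omega> :: "nat \<Rightarrow> plane set"
    and \<Gamma> :: "plane set" and \<phi> :: "plane \<Rightarrow> complex"
    and a :: "index \<Rightarrow> complex" and K K' :: "index set"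
    and p :: "plane \<Rightarrow> complex \<times> complex"
  assumes "minimal_pw_linear_rep u J \<alpha> \<beta> \<Omega>"
    and "\<Gamma> = (\<Union>j\<in>{1..J}. frontier (\<Omega> j))"
    and "\<Gamma> \<subseteq> {x. \<phi> x = 0}"
    and "\<phi> = (\<lambda>x. \<Sum>k\<in>K. a k * exp_char (lattice_pt k) x)"
    and "minimal_trig_poly \<Gamma> a"
    and "smallest_rect_supp a K"
    and "integrable lebesgue p"
    and "compact (closure {x. p x \<noteq> 0})"
    and "\<And>\<xi> T. T \<in> set (grad_minus u p) \<Longrightarrow> (\<Sum>k\<in>K. fourier T (\<xi> + lattice_pt k) * a k) = 0"
    and "\<And>\<xi> T. T \<in> set (sym_grad p) \<Longrightarrow> (\<Sum>k\<in>K. fourier T (\<xi> + lattice_pt k) * a k) = 0"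
    and "sym_rect K'"
    and "K \<subset> K'"
  defines "H1 \<equiv> multi_hankel (sample_grid N) K' (lattice_samples (grad_minus u p))"
    and "H2 \<equiv> multi_hankel (sample_grid N) K' (lattice_samples (sym_grad p))"
  shows "mat_rank H1 \<le> card K' - card (K' |:| K) \<and>
         mat_rank H2 \<le> card K' - card (K' |:| K) \<and>
         mat_rank H1 < card K' \<and> mat_kernel H1 \<noteq> {0\<^sub>v (card K')} \<and>
         mat_rank H2 < card K' \<and> mat_kernel H2 \<noteq> {0\<^sub>v (card K')}"
proof -
  have K': "finite K'" "0 \<in> K'"
    using assms(11) by (auto simp: sym_rect_def zero_prod_def)
  have K: "K \<subseteq> K'" "coeff_supp a \<subseteq> K"
    using assms(6,12) by (auto simp: smallest_rect_supp_def)
  \<comment> \<open>An empty support would make the trigonometric polynomial the zero function,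
    which minimality excludes.\<close>
  have supp: "coeff_supp a \<noteq> {}"
    using assms(5) by (auto simp: minimal_trig_poly_def vanishing_trig_poly_def trig_poly_def)
  note ann1 = lattice_samples_annihilated[OF assms(9)]
    and ann2 = lattice_samples_annihilated[OF assms(10)]
  note deficient = multi_hankel_rank_deficient[OF K' K supp, where G = "sample_grid N"]
  show ?thesis
    unfolding H1_def H2_def
    by (intro conjI deficient ann1 ann2)
qed

end
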